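(* Let $D$ be a decidable domain presented by a language $L$, let $L^{+}$ adjoin the parametrised gate $\mathrm{ask}(\cdot)$, and let $(a_k)_{k\in\mathbb{N}}$ be the iterates. For each $p$ there is a Boolean function $F_p:\{0,1\}^{Q(p)}\to\{0,1\}$, computable uniformly from $\nu(p)$, with $$a_{k+1}(p)=F_p\bigl(a_k\!\restriction\! Q(p)\bigr)\quad\text{for all }k.$$ Hence the hierarchy $(a_k)_k$ is the synchronous update of a Boolean network on the query graph (with each $p$ depending on the members of $Q(p)$), started at the all-zero state.
   Context: A domain $D$ presented by a language $L$ with a computable numbering of its systems has a manifestation predicate $\mathbf{M}_D$; it is decidable if it is decidable whether a given system manifests. $L^{+}$ is obtained from $L$ by adjoining a gate $\mathrm{ask}(q)$ with a parameter $q\in\mathbb{N}$; $L^+$ is a decidable set of finite syntactic objects with a fixed computable numbering $\nu:\mathbb{N}\to L^{+}$ extending that of $L$. Assigning a value in $\{0,1\}=\{\text{void},\text{mark}\}$ to every occurring gate turns a system of $L^+$ into a gate-free system of $L$, which is evaluated as in $L$. Iterates: $a_0(p)=0$ for all $p$; $a_{k+1}(p)=1$ if the system $\nu(p)$, evaluated with each occurrence of $\mathrm{ask}(q)$ returning $a_k(q)$, fails to manifest, and $a_{k+1}(p)=0$ otherwise. $Q(p)=\{q:\mathrm{ask}(q)\text{ occurs in }\nu(p)\}$ (a finite set). *)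

theory Defs
  imports Main "HOL-Library.FuncSet" "HOL-Library.Nat_Bijection"
begin

datatype recf =
    Zero
  | Succ
  | Proj nat
  | Comp recf "recf list"
  | Prim recf recf
  | Mu recf

text \<open>
  \<open>rec_eval f xs y\<close>: the partial recursive function described by \<open>f\<close> is defined on the
  arguments \<open>xs\<close> and has the value \<open>y\<close> there. In \<open>Prim\<close> and \<open>Mu\<close> the recursion variable,
  respectively the search variable, is the first argument.
\<close>

inductive rec_eval :: "recf \<Rightarrow> nat list \<Rightarrow> nat \<Rightarrow> bool" where
  Zero: "rec_eval Zero xs 0"
| Succ: "rec_eval Succ [x] (Suc x)"
| Proj: "i < length xs \<Longrightarrow> rec_eval (Proj i) xs (xs ! i)"
| Comp: "list_all2 (\<lambda>g y. rec_eval g xs y) gs ys \<Longrightarrow> rec_eval f ys z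
    \<Longrightarrow> rec_eval (Comp f gs) xs z"
| Prim_0: "rec_eval f xs y \<Longrightarrow> rec_eval (Prim f g) (0 # xs) y"
| Prim_Suc: "rec_eval (Prim f g) (n # xs) y \<Longrightarrow> rec_eval g (n # y # xs) z
    \<Longrightarrow> rec_eval (Prim f g) (Suc n # xs) z"
| Mu: "rec_eval f (n # xs) 0 \<Longrightarrow> (\<forall>i<n. \<exists>y. rec_eval f (i # xs) (Suc y))
    \<Longrightarrow> rec_eval (Mu f) xs n"

lemma rec_eval_deterministic:
  "rec_eval f xs y \<Longrightarrow> rec_eval f xs z \<Longrightarrow> y = z"
proof (induction arbitrary: z rule: rec_eval.induct)
  case (Comp xs gs ys f z')
  from Comp.prems obtain ys' where
    ys': "list_all2 (\<lambda>g y. rec_eval g xs y) gs ys'" "rec_eval f ys' z"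
    by (cases rule: rec_eval.cases) auto
  have "ys = ys'"
    using Comp.IH(1) ys'(1) by (auto simp: list_all2_conv_all_nth intro!: nth_equalityI)
  then show ?case using Comp.IH(2) ys'(2) by simp
next
  case (Prim_0 f xs y g)
  from Prim_0.prems show ?case
    by (cases rule: rec_eval.cases) (auto intro: Prim_0.IH)
next
  case (Prim_Suc f g n xs y z')
  from Prim_Suc.prems obtain y' where
    y': "rec_eval (Prim f g) (n # xs) y'" "rec_eval g (n # y' # xs) z"
    by (cases rule: rec_eval.cases) auto
  then show ?case using Prim_Suc.IH by blast
next
  case (Mu f n xs)
  from Mu.prems have z: "rec_eval f (z # xs) 0" "\<forall>i<z. \<exists>y. rec_eval f (i # xs) (Suc y)"
    by (cases rule: rec_eval.cases; auto)+
  show ?case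
  proof (rule linorder_cases[of n z])
    assume "n < z"
    then show ?thesis using z(2) Mu.IH(1) by blast
  next
    assume "z < n"
    then show ?thesis using z(1) Mu.IH(2) by blast
  qed
qed (auto elim: rec_eval.cases)

definition computable :: "(nat \<Rightarrow> nat) \<Rightarrow> bool" where
  "computable f \<longleftrightarrow> (\<exists>r. \<forall>n. rec_eval r [n] (f n))"

text \<open>
  Finite syntactic objects are written as words over a countable alphabet, in which every
  occurrence of a gate \<open>ask(q)\<close> is one letter.
\<close>

datatype letter = Sym nat | Ask nat

type_synonym word = "letter list"

definition letter_code :: "letter \<Rightarrow> nat" where
  "letter_code l = sum_encode (case l of Sym c \<Rightarrow> Inl c | Ask q \<Rightarrow> Inr q)"

definition word_code :: "word \<Rightarrow> nat" where
  "word_code w = list_encode (map letter_code w)"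

definition gates :: "word \<Rightarrow> nat set" where
  "gates w = {q. Ask q \<in> set w}"

text \<open>
  Truth values stand for gate values: \<open>False\<close> is \<open>0\<close> (void) and \<open>True\<close> is \<open>1\<close> (mark).
  \<open>cnst\<close> gives the notation of the two values in the language; it may be any two words, for
  instance the empty word for void.
\<close>

definition assign :: "(bool \<Rightarrow> word) \<Rightarrow> (nat \<Rightarrow> bool) \<Rightarrow> word \<Rightarrow> word" where
  "assign cnst s w = concat (map (\<lambda>l. case l of Sym c \<Rightarrow> [Sym c] | Ask q \<Rightarrow> cnst (s q)) w)"

definition decidable_language :: "word set \<Rightarrow> bool" where
  "decidable_language A \<longleftrightarrow> (\<exists>r. \<forall>w. rec_eval r [word_code w] (of_bool (w \<in> A)))"

definition computable_numbering :: "word set \<Rightarrow> (nat \<Rightarrow> word) \<Rightarrow> bool" where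
  "computable_numbering A num \<longleftrightarrow> range num = A \<and> computable (\<lambda>n. word_code (num n))"

definition decidable_domain :: "word set \<Rightarrow> (nat \<Rightarrow> word) \<Rightarrow> (word \<Rightarrow> bool) \<Rightarrow> bool" where
  "decidable_domain L num manifests \<longleftrightarrow>
     (\<forall>w\<in>L. gates w = {}) \<and>
     computable_numbering L num \<and>
     (\<exists>r. \<forall>w\<in>L. rec_eval r [word_code w] (of_bool (manifests w)))"

text \<open>
  Since both numberings are total on the natural numbers, that \<open>\<nu>\<close> extends \<open>num\<close> means that
  \<open>num\<close> factors through \<open>\<nu>\<close> by a computable translation of indices.
\<close>

definition ask_extension ::
    "word set \<Rightarrow> (nat \<Rightarrow> word) \<Rightarrow> (bool \<Rightarrow> word) \<Rightarrow> word set \<Rightarrow> (nat \<Rightarrow> word) \<Rightarrow> bool" where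
  "ask_extension L num cnst Lp \<nu> \<longleftrightarrow>
     L \<subseteq> Lp \<and>
     decidable_language Lp \<and>
     computable_numbering Lp \<nu> \<and>
     (\<exists>e. computable e \<and> (\<forall>n. \<nu> (e n) = num n)) \<and>
     (\<forall>w\<in>Lp. \<forall>s. assign cnst s w \<in> L)"

primrec iterate ::
    "(bool \<Rightarrow> word) \<Rightarrow> (word \<Rightarrow> bool) \<Rightarrow> (nat \<Rightarrow> word) \<Rightarrow> nat \<Rightarrow> nat \<Rightarrow> bool" where
  "iterate cnst manifests \<nu> 0 = (\<lambda>p. False)"
| "iterate cnst manifests \<nu> (Suc k) =
     (\<lambda>p. \<not> manifests (assign cnst (iterate cnst manifests \<nu> k) (\<nu> p)))"

definition queries :: "(nat \<Rightarrow> word) \<Rightarrow> nat \<Rightarrow> nat set" where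
  "queries \<nu> p = gates (\<nu> p)"

text \<open>An edge \<open>(p, q)\<close> says that \<open>p\<close> depends on \<open>q\<close>.\<close>

definition query_graph :: "(nat \<Rightarrow> word) \<Rightarrow> (nat \<times> nat) set" where
  "query_graph \<nu> = {(p, q). q \<in> queries \<nu> p}"

abbreviation boolean_functions :: "'v set \<Rightarrow> (('v \<Rightarrow> bool) \<Rightarrow> bool) set" where
  "boolean_functions A \<equiv> (A \<rightarrow>\<^sub>E UNIV) \<rightarrow>\<^sub>E UNIV"

definition boolean_network ::
    "('v \<times> 'v) set \<Rightarrow> ('v \<Rightarrow> ('v \<Rightarrow> bool) \<Rightarrow> bool) \<Rightarrow> bool" where
  "boolean_network E F \<longleftrightarrow>
     (\<forall>p. finite (E `` {p}) \<and> F p \<in> boolean_functions (E `` {p}))"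

definition sync_update ::
    "('v \<times> 'v) set \<Rightarrow> ('v \<Rightarrow> ('v \<Rightarrow> bool) \<Rightarrow> bool) \<Rightarrow> ('v \<Rightarrow> bool) \<Rightarrow> 'v \<Rightarrow> bool" where
  "sync_update E F x = (\<lambda>p. F p (restrict x (E `` {p})))"

text \<open>
  One algorithm, given the system \<open>\<nu> p\<close>, produces the domain \<open>Q(p)\<close> of the arguments of \<open>F p\<close>,
  and one evaluates \<open>F p\<close> at every argument; together they yield the truth table. An element of
  \<open>{0,1}\<^sup>Q\<close> is coded by the canonical index of the set on which it takes the value \<open>1\<close>.
\<close>

definition uniformly_computable ::
    "(nat \<Rightarrow> word) \<Rightarrow> (nat \<Rightarrow> (nat \<Rightarrow> bool) \<Rightarrow> bool) \<Rightarrow> bool" where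
  "uniformly_computable \<nu> F \<longleftrightarrow>
     (\<exists>r. \<forall>p. rec_eval r [word_code (\<nu> p)] (set_encode (queries \<nu> p))) \<and>
     (\<exists>r. \<forall>p. \<forall>s \<in> queries \<nu> p \<rightarrow>\<^sub>E UNIV.
        rec_eval r [word_code (\<nu> p), set_encode {q \<in> queries \<nu> p. s q}] (of_bool (F p s)))"

end

theory Submission
  imports Defs
begin

text \<open>
  Substituting constants for gates and collecting the gates of a word are folds over its letters,
  hence primitive recursive in the code of the word. So \<open>F p s\<close>, which substitutes \<open>s\<close> into
  \<open>\<nu> p\<close>, applies the decision procedure of the domain and negates, is computable from \<open>\<nu> p\<close>;
  it sees only the values of \<open>s\<close> on the gates of \<open>\<nu> p\<close>.
\<close>

section \<open>Closure properties of total recursive functions\<close>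

text \<open>Only argument lists of length \<open>n\<close> count, so \<open>f\<close> may use
  \<open>xs ! i\<close> or \<open>drop\<close> freely. Keeping the program existential lets the
  closure lemmas serve as introduction rules that follow the shape of a HOL term.\<close>

definition total_recursive :: "nat \<Rightarrow> (nat list \<Rightarrow> nat) \<Rightarrow> bool" where
  "total_recursive n f \<longleftrightarrow> (\<exists>r. \<forall>xs. length xs = n \<longrightarrow> rec_eval r xs (f xs))"

named_theorems recursive_intros

lemma total_recursive_cong:
  assumes "total_recursive n f" "\<And>xs. length xs = n \<Longrightarrow> f xs = g xs"
  shows "total_recursive n g"
  using assms unfolding total_recursive_def by metis

lemma total_recursive_nth [recursive_intros]:
  "i < n \<Longrightarrow> total_recursive n (\<lambda>xs. xs ! i)"
  unfolding total_recursive_def using rec_eval.Proj by blast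

lemma total_recursive_compose:
  assumes "total_recursive (length gs) f" "\<forall>g\<in>set gs. total_recursive n g"
  shows "total_recursive n (\<lambda>xs. f (map (\<lambda>g. g xs) gs))"
proof -
  obtain r where r: "\<And>ys. length ys = length gs \<Longrightarrow> rec_eval r ys (f ys)"
    using assms(1) unfolding total_recursive_def by blast
  obtain c where c: "\<And>g xs. g \<in> set gs \<Longrightarrow> length xs = n \<Longrightarrow> rec_eval (c g) xs (g xs)"
    using assms(2) unfolding total_recursive_def by metis
  have "rec_eval (Comp r (map c gs)) xs (f (map (\<lambda>g. g xs) gs))" if "length xs = n" for xs
    by (rule rec_eval.Comp[where ys = "map (\<lambda>g. g xs) gs"])
      (auto simp: list_all2_conv_all_nth that intro!: r c)
  then show ?thesis unfolding total_recursive_def by blast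
qed

text \<open>Composition with the projections from \<open>m\<close> on. It lets a function of the
  parameters ignore arguments placed in front of them, as primitive recursion requires.\<close>

lemma total_recursive_drop:
  assumes "total_recursive n f"
  shows "total_recursive (m + n) (\<lambda>ys. f (drop m ys))"
proof (rule total_recursive_cong)
  show "total_recursive (m + n)
      (\<lambda>xs. f (map (\<lambda>g. g xs) (map (\<lambda>i xs. xs ! i) [m..<m + n])))"
    by (rule total_recursive_compose) (use assms in \<open>auto intro: total_recursive_nth\<close>)
next
  fix xs :: "nat list"
  assume "length xs = m + n"
  then have "map (\<lambda>g. g xs) (map (\<lambda>i xs. xs ! i) [m..<m + n]) = drop m xs"
    by (auto intro: nth_equalityI)
  then show "f (map (\<lambda>g. g xs) (map (\<lambda>i xs. xs ! i) [m..<m + n])) = f (drop m xs)"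
    by simp
qed

lemma total_recursive_drop2:
  "total_recursive n f \<Longrightarrow> total_recursive (Suc (Suc n)) (\<lambda>ys. f (drop 2 ys))"
  using total_recursive_drop[of n f 2] by simp

lemma total_recursive_nth_drop2 [recursive_intros]:
  "i < n \<Longrightarrow> total_recursive (Suc (Suc n)) (\<lambda>ys. drop 2 ys ! i)"
  by (rule total_recursive_drop2) (rule total_recursive_nth)

lemma total_recursive_Suc [recursive_intros]:
  assumes "total_recursive n f"
  shows "total_recursive n (\<lambda>xs. Suc (f xs))"
proof -
  have "rec_eval Succ ys (Suc (ys ! 0))" if "length ys = 1" for ys
    using that by (cases ys) (auto intro: rec_eval.Succ)
  then have "total_recursive (length [f]) (\<lambda>ys. Suc (ys ! 0))"
    unfolding total_recursive_def by auto
  from total_recursive_compose[OF this, of n] assms show ?thesis by simp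
qed

lemma total_recursive_const [recursive_intros]: "total_recursive n (\<lambda>_. c)"
proof (induction c)
  case 0
  show ?case unfolding total_recursive_def using rec_eval.Zero by blast
qed (rule total_recursive_Suc)

text \<open>\<open>Prim\<close> puts the counter and the previous value in front of the parameters,
  so the step finds the parameters in \<open>drop 2 ys\<close>. All arithmetic below is reduced to
  this scheme.\<close>

lemma total_recursive_rec_nat:
  assumes f: "total_recursive n f"
    and g: "total_recursive (Suc (Suc n)) (\<lambda>ys. g (ys ! 0) (ys ! 1) (drop 2 ys))"
    and h: "total_recursive n h"
  shows "total_recursive n (\<lambda>xs. rec_nat (f xs) (\<lambda>k y. g k y xs) (h xs))"
proof -
  obtain a where a: "\<And>xs. length xs = n \<Longrightarrow> rec_eval a xs (f xs)"
    using f unfolding total_recursive_def by blast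
  obtain b where "\<And>ys. length ys = Suc (Suc n) \<Longrightarrow>
      rec_eval b ys (g (ys ! 0) (ys ! 1) (drop 2 ys))"
    using g unfolding total_recursive_def by blast
  from this[of "k # y # xs" for k y xs]
  have b: "rec_eval b (k # y # xs) (g k y xs)" if "length xs = n" for k y xs
    using that by simp
  have "rec_eval (Prim a b) (m # xs) (rec_nat (f xs) (\<lambda>k y. g k y xs) m)"
    if "length xs = n" for m xs
    by (induction m) (use that a b in \<open>auto intro: rec_eval.Prim_0 rec_eval.Prim_Suc\<close>)
  then have "rec_eval (Prim a b) ys (rec_nat (f (tl ys)) (\<lambda>k y. g k y (tl ys)) (hd ys))"
    if "length ys = Suc n" for ys
    using that by (cases ys) auto
  then have "total_recursive (Suc n) (\<lambda>ys. rec_nat (f (tl ys)) (\<lambda>k y. g k y (tl ys)) (hd ys))"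
    unfolding total_recursive_def by blast
  \<comment> \<open>Composing with \<open>h\<close> followed by all projections feeds the computed
    bound \<open>h xs\<close> into the counter and leaves the parameters unchanged.\<close>
  then have "total_recursive n (\<lambda>xs. (\<lambda>ys. rec_nat (f (tl ys)) (\<lambda>k y. g k y (tl ys)) (hd ys))
      (map (\<lambda>g. g xs) (h # map (\<lambda>i xs. xs ! i) [0..<n])))"
    by (intro total_recursive_compose) (use h in \<open>auto intro: total_recursive_nth\<close>)
  moreover have "map (\<lambda>g. g xs) (map (\<lambda>i xs. xs ! i) [0..<n]) = xs" if "length xs = n"
    for xs :: "nat list"
    using that by (auto intro: nth_equalityI)
  ultimately show ?thesis
    by (elim total_recursive_cong) (simp del: map_map)
qed

text \<open>Replaces the two leading arguments by computed values while the parameters pass through.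
  It serves a step function that is called on components of a coded state.\<close>

lemma total_recursive_substitute2:
  assumes h: "total_recursive (Suc (Suc n)) (\<lambda>ys. h (ys ! 0) (ys ! 1) (drop 2 ys))"
    and "total_recursive (Suc (Suc n)) u" "total_recursive (Suc (Suc n)) v"
  shows "total_recursive (Suc (Suc n)) (\<lambda>ys. h (u ys) (v ys) (drop 2 ys))"
proof (rule total_recursive_cong)
  let ?gs = "u # v # map (\<lambda>i ys. ys ! i) [2..<Suc (Suc n)]"
  show "total_recursive (Suc (Suc n))
      (\<lambda>ys. (\<lambda>ys. h (ys ! 0) (ys ! 1) (drop 2 ys)) (map (\<lambda>g. g ys) ?gs))"
    by (rule total_recursive_compose)
      (use assms in \<open>auto intro: total_recursive_nth simp del: upt_Suc\<close>)
  fix ys :: "nat list"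
  assume "length ys = Suc (Suc n)"
  then have "map (\<lambda>g. g ys) (map (\<lambda>i ys. ys ! i) [2..<Suc (Suc n)]) = drop 2 ys"
    by (auto intro: nth_equalityI simp del: upt_Suc)
  then show "h (map (\<lambda>g. g ys) ?gs ! 0) (map (\<lambda>g. g ys) ?gs ! 1)
      (drop 2 (map (\<lambda>g. g ys) ?gs)) = h (u ys) (v ys) (drop 2 ys)"
    by (simp del: map_map upt_Suc)
qed

section \<open>Arithmetic\<close>

lemma total_recursive_if [recursive_intros]:
  assumes "total_recursive n c" "total_recursive n f" "total_recursive n g"
  shows "total_recursive n (\<lambda>xs. if c xs = 0 then f xs else g xs)"
proof -
  \<comment> \<open>A case distinction is a recursion whose step ignores both the counter and the
    previous value.\<close>
  have "(if c xs = 0 then f xs else g xs) = rec_nat (f xs) (\<lambda>_ _. g xs) (c xs)" for xs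
    by (cases "c xs") auto
  then show ?thesis
    by (simp only:) (intro total_recursive_rec_nat total_recursive_drop2 assms)
qed

lemma total_recursive_pred [recursive_intros]:
  assumes "total_recursive n f"
  shows "total_recursive n (\<lambda>xs. f xs - 1)"
proof -
  have "m - 1 = rec_nat 0 (\<lambda>k _. k) m" for m :: nat
    by (cases m) auto
  then show ?thesis
    by (simp only:) (intro total_recursive_rec_nat recursive_intros assms; simp)
qed

lemma total_recursive_add [recursive_intros]:
  assumes "total_recursive n f" "total_recursive n g"
  shows "total_recursive n (\<lambda>xs. f xs + g xs)"
proof -
  have "a + b = rec_nat a (\<lambda>_ y. Suc y) b" for a b :: nat
    by (induction b) auto
  then show ?thesis
    by (simp only:) (intro total_recursive_rec_nat recursive_intros assms; simp)
qed

lemma total_recursive_diff [recursive_intros]: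
  assumes "total_recursive n f" "total_recursive n g"
  shows "total_recursive n (\<lambda>xs. f xs - g xs)"
proof -
  have "a - b = rec_nat a (\<lambda>_ y. y - 1) b" for a b :: nat
    by (induction b) auto
  \<comment> \<open>The general equation has a difference on its right-hand side and would loop as a
    rewrite rule; this instance does not.\<close>
  from this[of "f xs" "g xs" for xs] show ?thesis
    by (simp only:) (intro total_recursive_rec_nat recursive_intros assms; simp)
qed

lemma total_recursive_mod2 [recursive_intros]:
  assumes "total_recursive n f"
  shows "total_recursive n (\<lambda>xs. f xs mod 2)"
proof -
  have "m mod 2 = rec_nat 0 (\<lambda>_ y. 1 - y) m" for m :: nat
    by (induction m) (auto simp: mod_Suc)
  then show ?thesis
    by (simp only:) (intro total_recursive_rec_nat recursive_intros assms; simp)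
qed

lemma total_recursive_div2 [recursive_intros]:
  assumes "total_recursive n f"
  shows "total_recursive n (\<lambda>xs. f xs div 2)"
proof -
  \<comment> \<open>The quotient grows exactly when the counter passes from an odd \<open>k\<close>
    to \<open>Suc k\<close>.\<close>
  have "m div 2 = rec_nat 0 (\<lambda>k y. y + k mod 2) m" for m :: nat
  proof (induction m)
    case (Suc m)
    have "Suc m div 2 = m div 2 + m mod 2" by presburger
    then show ?case using Suc by simp
  qed simp
  then show ?thesis
    by (simp only:) (intro total_recursive_rec_nat recursive_intros assms; simp)
qed

lemma total_recursive_div_pow2 [recursive_intros]:
  assumes "total_recursive n f" "total_recursive n g"
  shows "total_recursive n (\<lambda>xs. f xs div 2 ^ g xs)"
proof -
  have "a div 2 ^ b = rec_nat a (\<lambda>_ y. y div 2) b" for a b :: nat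
    by (induction b) (auto simp: div_mult2_eq mult.commute[of 2])
  then show ?thesis
    by (simp only:) (intro total_recursive_rec_nat recursive_intros assms; simp)
qed

lemma total_recursive_pow2 [recursive_intros]:
  assumes "total_recursive n f"
  shows "total_recursive n (\<lambda>xs. 2 ^ f xs)"
proof -
  have "2 ^ m = rec_nat (1 :: nat) (\<lambda>_ y. y + y) m" for m
    by (induction m) auto
  then show ?thesis
    by (simp only:) (intro total_recursive_rec_nat recursive_intros assms; simp)
qed

lemma total_recursive_triangle [recursive_intros]:
  assumes "total_recursive n f"
  shows "total_recursive n (\<lambda>xs. triangle (f xs))"
proof -
  have "triangle m = rec_nat 0 (\<lambda>k y. y + Suc k) m" for m
    by (induction m) auto
  then show ?thesis
    by (simp only:) (intro total_recursive_rec_nat recursive_intros assms; simp)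
qed

section \<open>Pairs and lists\<close>

lemma total_recursive_prod_encode [recursive_intros]:
  assumes "total_recursive n f" "total_recursive n g"
  shows "total_recursive n (\<lambda>xs. prod_encode (f xs, g xs))"
  unfolding prod_encode_def prod.case by (intro recursive_intros assms)

text \<open>The index of the Cantor antidiagonal through \<open>z\<close>. Since
  \<open>z = triangle (a + b) + a\<close> for the pair \<open>(a, b)\<close> coded by
  \<open>z\<close>, both components follow from it by subtraction.\<close>

definition diagonal :: "nat \<Rightarrow> nat" where
  "diagonal z = fst (prod_decode z) + snd (prod_decode z)"

lemma fst_prod_decode: "fst (prod_decode z) = z - triangle (diagonal z)"
  and snd_prod_decode: "snd (prod_decode z) = diagonal z - fst (prod_decode z)"
proof -
  have "z = prod_encode (fst (prod_decode z), snd (prod_decode z))" by simp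
  also have "\<dots> = triangle (diagonal z) + fst (prod_decode z)"
    by (simp only: prod_encode_def diagonal_def prod.case)
  finally show "fst (prod_decode z) = z - triangle (diagonal z)" by linarith
qed (simp add: diagonal_def)

text \<open>The enumeration runs along an antidiagonal until the second component is 0, then starts
  the next one.\<close>

lemma prod_decode_Suc:
  "prod_decode (Suc z) = (case prod_decode z of (a, b) \<Rightarrow> if b = 0 then (0, Suc a) else (Suc a, b - 1))"
proof -
  obtain a b where ab: "prod_decode z = (a, b)" by fastforce
  then have z: "z = prod_encode (a, b)" by (metis prod_decode_inverse)
  have "Suc z = prod_encode (if b = 0 then (0, Suc a) else (Suc a, b - 1))"
    by (cases b) (simp_all add: z prod_encode_def)
  then show ?thesis using ab by simp
qed

text \<open>The tested difference equals the second component of the pair at \<open>z\<close>, so it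
  vanishes exactly at the end of an antidiagonal. This turns \<open>diagonal\<close> into a
  primitive recursion.\<close>

lemma diagonal_Suc:
  "diagonal (Suc z) =
     (if triangle (Suc (diagonal z)) - Suc z = 0 then Suc (diagonal z) else diagonal z)"
proof -
  obtain a b where ab: "prod_decode z = (a, b)" by fastforce
  have z: "z = triangle (a + b) + a"
    using prod_decode_inverse[of z] by (simp add: ab prod_encode_def)
  have "triangle (Suc (a + b)) - Suc z = b"
    by (simp add: z)
  then show ?thesis by (simp add: diagonal_def ab prod_decode_Suc del: triangle_Suc)
qed

lemma total_recursive_diagonal [recursive_intros]:
  assumes "total_recursive n f"
  shows "total_recursive n (\<lambda>xs. diagonal (f xs))"
proof -
  have "diagonal 0 = 0"
    by (simp add: diagonal_def prod_decode_def prod_decode_aux.simps)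
  then have "diagonal m =
      rec_nat 0 (\<lambda>k y. if triangle (Suc y) - Suc k = 0 then Suc y else y) m" for m
    by (induction m) (simp_all add: diagonal_Suc del: triangle_Suc)
  then show ?thesis
    by (simp only:) (intro total_recursive_rec_nat recursive_intros assms; simp)
qed

lemma total_recursive_fst_prod_decode [recursive_intros]:
  assumes "total_recursive n f"
  shows "total_recursive n (\<lambda>xs. fst (prod_decode (f xs)))"
  unfolding fst_prod_decode by (intro recursive_intros assms)

lemma total_recursive_snd_prod_decode [recursive_intros]:
  assumes "total_recursive n f"
  shows "total_recursive n (\<lambda>xs. snd (prod_decode (f xs)))"
  unfolding snd_prod_decode by (intro recursive_intros assms)

text \<open>The code of a list thus bounds the number of fold steps, and no length function has to
  be computed.\<close>

lemma length_le_list_encode: "length l \<le> list_encode l"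
proof (induction l)
  case (Cons x l)
  have "list_encode l \<le> prod_encode (x, list_encode l)" by (rule le_prod_encode_2)
  with Cons show ?case by simp
qed simp

text \<open>One step of a left fold on a state that codes the pair of the remaining list and the
  accumulator; the state is fixed once the list is exhausted.\<close>

definition fold_step :: "(nat \<Rightarrow> nat \<Rightarrow> nat) \<Rightarrow> nat \<Rightarrow> nat" where
  "fold_step h \<sigma> =
     (if fst (prod_decode \<sigma>) = 0 then \<sigma>
      else prod_encode
        (snd (prod_decode (fst (prod_decode \<sigma>) - 1)),
         h (fst (prod_decode (fst (prod_decode \<sigma>) - 1))) (snd (prod_decode \<sigma>))))"

text \<open>Surplus steps are harmless: the empty list has code 0, and such a state is
  fixed.\<close>

lemma funpow_fold_step:
  "length l \<le> k \<Longrightarrow> (fold_step h ^^ k) (prod_encode (list_encode l, a)) = prod_encode (0, fold h l a)"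
proof (induction k arbitrary: l a)
  case (Suc k)
  show ?case
  proof (cases l)
    case Nil
    then have "fold_step h (prod_encode (list_encode l, a)) = prod_encode (list_encode l, a)"
      by (simp add: fold_step_def)
    then show ?thesis using Suc.IH[of "[]" a] Nil by (simp add: funpow_Suc_right del: funpow.simps)
  next
    case (Cons x l')
    then have "fold_step h (prod_encode (list_encode l, a)) = prod_encode (list_encode l', h x a)"
      by (simp add: fold_step_def)
    then show ?thesis using Suc Cons by (simp add: funpow_Suc_right del: funpow.simps)
  qed
qed simp

lemma total_recursive_fold:
  assumes h: "total_recursive (Suc (Suc n)) (\<lambda>ys. h (ys ! 0) (ys ! 1) (drop 2 ys))"
    and f: "total_recursive n f" and g: "total_recursive n g"
  shows "total_recursive n (\<lambda>xs. fold (\<lambda>x a. h x a xs) (list_decode (f xs)) (g xs))"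
proof -
  have rec_nat_funpow: "rec_nat s (\<lambda>_. t) k = (t ^^ k) s" for s k and t :: "nat \<Rightarrow> nat"
    by (induction k) auto
  have "fold (\<lambda>x a. h x a xs) (list_decode (f xs)) (g xs) = snd (prod_decode
      (rec_nat (prod_encode (f xs, g xs)) (\<lambda>_. fold_step (\<lambda>x a. h x a xs)) (f xs)))" for xs
    using funpow_fold_step[of "list_decode (f xs)" "f xs"] length_le_list_encode[of "list_decode (f xs)"]
    by (simp add: rec_nat_funpow)
  moreover have "total_recursive (Suc (Suc n))
      (\<lambda>ys. fold_step (\<lambda>x a. h x a (drop 2 ys)) (ys ! 1))"
    unfolding fold_step_def
    \<comment> \<open>The head of the list and the accumulator, both decoded from the state
      \<open>ys ! 1\<close>, become the leading arguments of \<open>h\<close>.\<close>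
    by (intro total_recursive_substitute2[OF h] recursive_intros; simp)
  ultimately show ?thesis
    by (simp only:) (intro total_recursive_rec_nat recursive_intros f g)
qed

section \<open>Words\<close>

text \<open>Parity separates symbols from gates, and halving the code of a gate recovers its
  parameter.\<close>

lemma letter_code_simps [simp]:
  "letter_code (Sym c) = 2 * c" "letter_code (Ask q) = Suc (2 * q)"
  by (simp_all add: letter_code_def sum_encode_def)

section \<open>Canonical index of the set of gates of a word\<close>

definition insert_code :: "nat \<Rightarrow> nat \<Rightarrow> nat" where
  "insert_code q m = (if (m div 2 ^ q) mod 2 = 0 then m + 2 ^ q else m)"

lemma finite_gates [simp]: "finite (gates w)"
  by (rule finite_subset[of _ "(\<lambda>l. case l of Ask q \<Rightarrow> q | Sym c \<Rightarrow> c) ` set w"])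
    (force simp: gates_def)+

text \<open>The binary digits of a canonical index form the characteristic function of the set, so
  membership is one bit. \<open>insert_code\<close> tests it first, since adding
  \<open>2 ^ q\<close> to a set bit would carry.\<close>

lemma mem_iff_set_encode: "finite A \<Longrightarrow> q \<in> A \<longleftrightarrow> (set_encode A div 2 ^ q) mod 2 \<noteq> 0"
  using set_encode_inverse[of A] by (auto simp: set_decode_def even_iff_mod_2_eq_zero)

lemma insert_code: "finite A \<Longrightarrow> insert_code q (set_encode A) = set_encode (insert q A)"
  using mem_iff_set_encode[of A q] by (auto simp: insert_code_def insert_absorb)

definition gate_step :: "nat \<Rightarrow> nat \<Rightarrow> nat" where
  "gate_step x a = (if x mod 2 = 0 then a else insert_code (x div 2) a)"

lemma fold_gate_step:
  "finite A \<Longrightarrow> fold gate_step (map letter_code w) (set_encode A) = set_encode (A \<union> gates w)"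
proof (induction w arbitrary: A)
  case (Cons l w)
  show ?case
  proof (cases l)
    case (Sym c)
    then have "gates (l # w) = gates w" by (simp add: gates_def)
    then show ?thesis using Cons Sym by (simp add: gate_step_def)
  next
    case (Ask q)
    then have "A \<union> gates (l # w) = insert q A \<union> gates w" by (auto simp: gates_def)
    then show ?thesis using Cons Ask by (simp add: gate_step_def insert_code)
  qed
qed (simp add: gates_def)

lemma set_encode_gates_recursive:
  "\<exists>r. \<forall>w. rec_eval r [word_code w] (set_encode (gates w))"
proof -
  have "total_recursive 1 (\<lambda>xs. fold gate_step (list_decode (xs ! 0)) 0)"
    unfolding gate_step_def insert_code_def
    by (intro total_recursive_fold recursive_intros; simp)
  then obtain r where
    r: "\<And>xs. length xs = 1 \<Longrightarrow> rec_eval r xs (fold gate_step (list_decode (xs ! 0)) 0)"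
    unfolding total_recursive_def by blast
  have "rec_eval r [word_code w] (set_encode (gates w))" for w
    using r[of "[word_code w]"] fold_gate_step[of "{}" w] by (simp add: word_code_def)
  then show ?thesis by blast
qed

section \<open>Substitution of constants for gates on codes\<close>

definition cons_code :: "nat \<Rightarrow> nat \<Rightarrow> nat" where
  "cons_code x a = Suc (prod_encode (x, a))"

text \<open>Used in two ways: started at 0 it reverses a coded list, and applied to a reversed word
  it prepends that word.\<close>

lemma fold_cons_code: "fold cons_code l (list_encode l') = list_encode (rev l @ l')"
  by (induction l arbitrary: l') (simp_all add: cons_code_def flip: list_encode.simps)

lemma total_recursive_cons_code [recursive_intros]:
  "total_recursive n f \<Longrightarrow> total_recursive n g \<Longrightarrow> total_recursive n (\<lambda>xs. cons_code (f xs) (g xs))"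
  unfolding cons_code_def by (intro recursive_intros)

text \<open>Here \<open>l\<close> is a fixed list, such as the reversed codes of a word of
  \<open>cnst\<close>, so the fold is a finite composition of \<open>cons_code\<close>.\<close>

lemma total_recursive_fold_cons_code [recursive_intros]:
  assumes "total_recursive n f"
  shows "total_recursive n (\<lambda>xs. fold cons_code l (f xs))"
  using assms by (induction l arbitrary: f) (simp_all add: recursive_intros)

text \<open>The fold prepends, so it consumes the letters of a word from the last to the first.\<close>

definition assign_step :: "(bool \<Rightarrow> word) \<Rightarrow> nat \<Rightarrow> nat \<Rightarrow> nat \<Rightarrow> nat" where
  "assign_step cnst m x a =
     (if x mod 2 = 0 then cons_code x a
      else if (m div 2 ^ (x div 2)) mod 2 = 0
        then fold cons_code (rev (map letter_code (cnst False))) a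
        else fold cons_code (rev (map letter_code (cnst True))) a)"

lemma fold_assign_step:
  assumes "finite A"
  shows "fold (assign_step cnst (set_encode A)) (rev (map letter_code w)) 0 =
    word_code (assign cnst (\<lambda>q. q \<in> A) w)"
proof (induction w)
  case (Cons l w)
  show ?case
  proof (cases l)
    case (Sym c)
    then show ?thesis using Cons
      by (simp add: assign_step_def assign_def word_code_def cons_code_def)
  next
    case (Ask q)
    then show ?thesis using Cons mem_iff_set_encode[OF assms, of q]
      by (simp add: assign_step_def assign_def word_code_def fold_cons_code)
  qed
qed (simp add: assign_def word_code_def)

lemma assign_recursive:
  "\<exists>r. \<forall>w A. finite A \<longrightarrow>
     rec_eval r [word_code w, set_encode A] (word_code (assign cnst (\<lambda>q. q \<in> A) w))"
proof -
  \<comment> \<open>Reversal on codes, so that the next fold meets the last letter first.\<close>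
  let ?rev = "\<lambda>x. fold cons_code (list_decode x) 0"
  have "total_recursive 2 (\<lambda>xs. fold (\<lambda>x a. assign_step cnst (xs ! 1) x a)
      (list_decode (?rev (xs ! 0))) 0)"
    unfolding assign_step_def
    by (intro total_recursive_fold recursive_intros; simp)
  then obtain r where r: "\<And>xs. length xs = 2 \<Longrightarrow>
      rec_eval r xs (fold (assign_step cnst (xs ! 1)) (list_decode (?rev (xs ! 0))) 0)"
    unfolding total_recursive_def by blast
  have "rec_eval r [word_code w, set_encode A] (word_code (assign cnst (\<lambda>q. q \<in> A) w))"
    if "finite A" for w A
    using r[of "[word_code w, set_encode A]"] fold_assign_step[OF that, of cnst w]
      fold_cons_code[of "map letter_code w" "[]"]
    by (simp add: word_code_def)
  then show ?thesis by blast
qed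

text \<open>Only gates that occur in \<open>w\<close> are read. Hence a state may be replaced by its
  restriction to the gates, or by the coded set of gates on which it is true.\<close>

lemma assign_cong:
  assumes "\<And>q. q \<in> gates w \<Longrightarrow> s q = t q"
  shows "assign cnst s w = assign cnst t w"
  unfolding assign_def
  by (intro arg_cong[where f = concat] map_cong) (use assms in \<open>auto simp: gates_def split: letter.split\<close>)

lemma not_recursive: "\<exists>r. \<forall>b. rec_eval r [of_bool b] (of_bool (\<not> b))"
proof -
  have "total_recursive 1 (\<lambda>xs. 1 - xs ! 0)"
    by (intro recursive_intros) simp
  then obtain r where r: "\<And>xs. length xs = 1 \<Longrightarrow> rec_eval r xs (1 - xs ! 0)"
    unfolding total_recursive_def by blast
  have "rec_eval r [of_bool b] (of_bool (\<not> b))" for b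
    using r[of "[of_bool b]"] by (cases b) auto
  then show ?thesis by blast
qed

theorem lemma5p2:
  fixes L Lp :: "word set"
    and num \<nu> :: "nat \<Rightarrow> word"
    and manifests :: "word \<Rightarrow> bool"
    and cnst :: "bool \<Rightarrow> word"
  assumes "decidable_domain L num manifests"
    and "ask_extension L num cnst Lp \<nu>"
  shows "\<exists>F. (\<forall>p. F p \<in> boolean_functions (queries \<nu> p)) \<and>
             uniformly_computable \<nu> F \<and>
             (\<forall>p k. iterate cnst manifests \<nu> (Suc k) p =
                    F p (restrict (iterate cnst manifests \<nu> k) (queries \<nu> p))) \<and>
             boolean_network (query_graph \<nu>) F \<and>
             (\<forall>k. iterate cnst manifests \<nu> k =
                  (sync_update (query_graph \<nu>) F ^^ k) (\<lambda>p. False))"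
proof -
  \<comment> \<open>The restriction makes \<open>F p\<close> extensional, as
    \<open>boolean_functions\<close> demands; arguments outside its domain get
    \<open>undefined\<close>.\<close>
  define F where "F p = restrict (\<lambda>s. \<not> manifests (assign cnst s (\<nu> p)))
    (queries \<nu> p \<rightarrow>\<^sub>E UNIV)" for p
  have F: "F p \<in> boolean_functions (queries \<nu> p)" for p
    by (simp add: F_def)
  have image_query_graph: "query_graph \<nu> `` {p} = queries \<nu> p" for p
    by (auto simp: query_graph_def)
  have iterate_Suc: "iterate cnst manifests \<nu> (Suc k) p =
      F p (restrict (iterate cnst manifests \<nu> k) (queries \<nu> p))" for p k
    using assign_cong[of "\<nu> p" "restrict (iterate cnst manifests \<nu> k) (queries \<nu> p)"
        "iterate cnst manifests \<nu> k" cnst]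
    by (simp add: F_def queries_def)
  have "iterate cnst manifests \<nu> k = (sync_update (query_graph \<nu>) F ^^ k) (\<lambda>p. False)" for k
  proof (induction k)
    case (Suc k)
    have "iterate cnst manifests \<nu> (Suc k) =
        sync_update (query_graph \<nu>) F (iterate cnst manifests \<nu> k)"
      unfolding sync_update_def image_query_graph using iterate_Suc by blast
    with Suc show ?case by simp
  qed simp
  moreover have "boolean_network (query_graph \<nu>) F"
    unfolding boolean_network_def image_query_graph using F by (simp add: queries_def)
  moreover have "uniformly_computable \<nu> F"
  proof -
    obtain g where "\<And>w. rec_eval g [word_code w] (set_encode (gates w))"
      using set_encode_gates_recursive by blast
    moreover obtain d where d: "\<And>w. w \<in> L \<Longrightarrow> rec_eval d [word_code w] (of_bool (manifests w))"
      using assms(1) unfolding decidable_domain_def by blast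
    obtain a where a: "\<And>w A. finite A \<Longrightarrow>
        rec_eval a [word_code w, set_encode A] (word_code (assign cnst (\<lambda>q. q \<in> A) w))"
      using assign_recursive by blast
    obtain c where c: "\<And>b. rec_eval c [of_bool b] (of_bool (\<not> b))"
      using not_recursive by blast
    \<comment> \<open>The program substitutes with \<open>a\<close>, decides manifestation with
      \<open>d\<close> and negates with \<open>c\<close>.\<close>
    have "rec_eval (Comp c [Comp d [a]]) [word_code (\<nu> p), set_encode {q \<in> queries \<nu> p. s q}]
        (of_bool (F p s))" if s: "s \<in> queries \<nu> p \<rightarrow>\<^sub>E UNIV" for p s
    proof -
      let ?A = "{q \<in> queries \<nu> p. s q}"
      have A: "assign cnst (\<lambda>q. q \<in> ?A) (\<nu> p) = assign cnst s (\<nu> p)"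
        by (rule assign_cong) (simp add: queries_def)
      \<comment> \<open>The decision procedure \<open>d\<close> is guaranteed only on codes of
        systems in \<open>L\<close>; \<open>\<nu> p\<close> lies in \<open>Lp\<close>, the range of
        \<open>\<nu>\<close>, and substitution leads from there into \<open>L\<close>.\<close>
      have "assign cnst s (\<nu> p) \<in> L"
        using assms(2) unfolding ask_extension_def computable_numbering_def by blast
      from d[OF this] have "rec_eval (Comp d [a]) [word_code (\<nu> p), set_encode ?A]
          (of_bool (manifests (assign cnst s (\<nu> p))))"
        using a[of ?A "\<nu> p"] A
        by (intro rec_eval.Comp[where ys = "[word_code (assign cnst s (\<nu> p))]"])
          (simp_all add: queries_def)
      then show ?thesis using c s
        by (intro rec_eval.Comp[where ys = "[of_bool (manifests (assign cnst s (\<nu> p)))]"])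
          (simp_all add: F_def)
    qed
    ultimately show ?thesis
      unfolding uniformly_computable_def queries_def by blast
  qed
  ultimately show ?thesis
    using F iterate_Suc by blast
qed

end
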